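(* There is an absolute constant $C>0$ such that for every positive integer $n$ and every set $A \subseteq \{0,1\}^n$ with $|A| = 2^{n-1}$ there exists a bijection $\phi \colon \{0,1\}^{n-1} \to A$ with $\mathrm{avgstretch}(\phi) \le C\sqrt{n}$.
   Context: $\mathrm{dist}$ denotes the Hamming distance. For a bijection $\phi \colon \{0,1\}^{n-1} \to A$, where $A \subseteq \{0,1\}^n$, the average stretch is $\mathrm{avgstretch}(\phi) = \mathbb{E}[\mathrm{dist}(\phi(x),\phi(x'))]$, where the expectation is over a uniformly random pair $x,x' \in \{0,1\}^{n-1}$ differing in exactly one coordinate (equivalently, $x$ uniform in $\{0,1\}^{n-1}$ and $x' = x+e_i$ with $i$ uniform in $[n-1]$). *)

theory Defs
  imports Complex_Main
begin

definition cube :: "nat \<Rightarrow> bool list set" where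
  "cube n = {x. length x = n}"

text \<open>Hamming distance; only meaningful for lists of equal length.\<close>
definition hdist :: "bool list \<Rightarrow> bool list \<Rightarrow> nat" where
  "hdist x y = card {i. i < length x \<and> x ! i \<noteq> y ! i}"

text \<open>Ordered pairs of points of the cube differing in exactly one coordinate.\<close>
definition cube_edges :: "nat \<Rightarrow> (bool list \<times> bool list) set" where
  "cube_edges m = {(x, x'). x \<in> cube m \<and> x' \<in> cube m \<and> hdist x x' = 1}"

text \<open>
  Expectation of the stretch over a uniformly random element of \<^term>\<open>cube_edges m\<close>.
  For \<open>m = 0\<close> there are no such pairs, and the value is \<open>0 / 0 = 0\<close>.
\<close>
definition avgstretch :: "nat \<Rightarrow> (bool list \<Rightarrow> bool list) \<Rightarrow> real" where
  "avgstretch m \<phi> =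
     (\<Sum>(x, x')\<in>cube_edges m. real (hdist (\<phi> x) (\<phi> x'))) / real (card (cube_edges m))"

end

theory Submission
  imports Defs "HOL-Analysis.Convex"
begin

text \<open>
  Identify the \<open>(n-1)\<close>-cube with the facet \<open>B = {x. x\<^sub>0 = 0}\<close> and let \<open>\<phi>\<close> be a bijection from \<open>B\<close>
  to \<open>A\<close> of minimal total transport cost \<open>\<Sum>b. dist b (\<phi> b)\<close>. By the triangle inequality the average
  stretch is at most one plus twice the average cost. By duality the cost equals
  \<open>\<Sum>\<^sub>A f - \<Sum>\<^sub>B f\<close> for some 1-Lipschitz \<open>f\<close> on the \<open>n\<close>-cube. Such an \<open>f\<close> has variance at most \<open>n/4\<close>
  (Poincare inequality), so by Cauchy--Schwarz its averages over the sets \<open>A\<close> and \<open>B\<close> of density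
  one half are each within \<open>sqrt (n/2)\<close> of its mean.
\<close>

section \<open>Hall's theorem and optimal transport duality\<close>

text \<open>Induction on the number of indices. A nonempty proper subfamily with exactly as many
  values as indices is matched first; Hall's condition survives for the other indices once those
  values are removed. If there is no such subfamily, every nonempty proper subfamily has a spare
  value, so one index may take any of its values.\<close>

lemma Hall_marriage:
  assumes "finite I" and "\<And>i. i \<in> I \<Longrightarrow> finite (F i)"
    and "\<And>J. J \<subseteq> I \<Longrightarrow> card J \<le> card (\<Union>i\<in>J. F i)"
  shows "\<exists>g. inj_on g I \<and> (\<forall>i\<in>I. g i \<in> F i)"
  using assms
proof (induction "card I" arbitrary: I F rule: less_induct)
  case less
  note fin = less.prems(1) and finF = less.prems(2) and hall = less.prems(3)
  show ?case
  proof (cases "I = {}")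
    case True
    then show ?thesis by auto
  next
    case False
    show ?thesis
    proof (cases "\<exists>K. K \<noteq> {} \<and> K \<subset> I \<and> card (\<Union>i\<in>K. F i) = card K")
      case True
      then obtain K where K: "K \<noteq> {}" "K \<subset> I" "card (\<Union>i\<in>K. F i) = card K"
        by blast
      define T where "T = (\<Union>i\<in>K. F i)"
      have finK: "finite K" using K fin by (meson finite_subset psubset_imp_subset)
      have "card K < card I" using K fin by (simp add: psubset_card_mono)
      then have "\<exists>g. inj_on g K \<and> (\<forall>i\<in>K. g i \<in> F i)"
        using less.hyps[of K F] finK finF hall K by (metis psubsetE subset_iff)
      then obtain g where g: "inj_on g K" "\<forall>i\<in>K. g i \<in> F i" by blast
      have "card (I - K) < card I"
        using K fin by (intro psubset_card_mono) auto
      moreover have "card J \<le> card (\<Union>i\<in>J. F i - T)" if J: "J \<subseteq> I - K" for J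
      proof -
        have finJ: "finite J" using J fin by (meson finite_Diff finite_subset)
        \<comment> \<open>Hall's condition for \<open>J \<union> K\<close>, with
          \<open>card T = card K\<close> cancelled, is what \<open>J\<close> needs outside
          \<open>T\<close>.\<close>
        have "card J + card K = card (J \<union> K)"
          using J finJ finK by (subst card_Un_disjoint) auto
        also have "\<dots> \<le> card (\<Union>i\<in>J \<union> K. F i)" using J K by (intro hall) auto
        also have "(\<Union>i\<in>J \<union> K. F i) = (\<Union>i\<in>J. F i - T) \<union> T" by (auto simp: T_def)
        also have "card \<dots> \<le> card (\<Union>i\<in>J. F i - T) + card T" by (rule card_Un_le)
        finally show ?thesis using K(3) by (simp add: T_def)
      qed
      ultimately have "\<exists>h. inj_on h (I - K) \<and> (\<forall>i\<in>I - K. h i \<in> F i - T)"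
        using less.hyps[of "I - K" "\<lambda>i. F i - T"] fin finF by auto
      then obtain h where h: "inj_on h (I - K)" "\<forall>i\<in>I - K. h i \<in> F i - T" by blast
      have "inj_on (\<lambda>i. if i \<in> K then g i else h i) I"
      proof (rule inj_onI)
        fix i j assume "i \<in> I" "j \<in> I"
          and eq: "(if i \<in> K then g i else h i) = (if j \<in> K then g j else h j)"
        have "g k \<in> T" if "k \<in> K" for k using g that by (auto simp: T_def)
        moreover have "h k \<notin> T" if "k \<in> I - K" for k using h that by auto
        ultimately have "i \<in> K \<longleftrightarrow> j \<in> K"
          using \<open>i \<in> I\<close> \<open>j \<in> I\<close> eq by (metis DiffI)
        then show "i = j"
          using \<open>i \<in> I\<close> \<open>j \<in> I\<close> eq g(1) h(1) by (auto dest: inj_onD split: if_splits)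
      qed
      then show ?thesis using g h by (intro exI[of _ "\<lambda>i. if i \<in> K then g i else h i"]) auto
    next
      case noK: False
      obtain i where i: "i \<in> I" using False by blast
      have "card {i} \<le> card (\<Union>j\<in>{i}. F j)" using i by (intro hall) auto
      then have "F i \<noteq> {}" by auto
      then obtain t where t: "t \<in> F i" by blast
      have "card (I - {i}) < card I" using i fin by (intro card_Diff1_less)
      moreover have "card J \<le> card (\<Union>j\<in>J. F j - {t})" if J: "J \<subseteq> I - {i}" for J
      proof (cases "J = {}")
        case False
        have "J \<subset> I" using J i by auto
        \<comment> \<open>\<open>J\<close> is not critical, so it has at least
          \<open>card J + 1\<close> values and can afford to lose \<open>t\<close>.\<close>
        then have "card (\<Union>j\<in>J. F j) \<noteq> card J" "card J \<le> card (\<Union>j\<in>J. F j)"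
          using noK False hall by auto
        moreover have "(\<Union>j\<in>J. F j - {t}) = (\<Union>j\<in>J. F j) - {t}" by auto
        moreover have "card (\<Union>j\<in>J. F j) \<le> Suc (card ((\<Union>j\<in>J. F j) - {t}))"
          using diff_card_le_card_Diff[of "{t}" "\<Union>j\<in>J. F j"] by simp
        ultimately show ?thesis by simp
      qed simp
      ultimately have "\<exists>h. inj_on h (I - {i}) \<and> (\<forall>j\<in>I - {i}. h j \<in> F j - {t})"
        using less.hyps[of "I - {i}" "\<lambda>j. F j - {t}"] fin finF by auto
      then obtain h where h: "inj_on h (I - {i})" "\<forall>j\<in>I - {i}. h j \<in> F j - {t}" by blast
      have "inj_on (h(i := t)) I"
        using h unfolding inj_on_def by auto
      then show ?thesis using h t by (intro exI[of _ "h(i := t)"]) auto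
    qed
  qed
qed

text \<open>
  A function \<open>f\<close> maximising the dual objective is tight on enough pairs for Hall's condition:
  if it failed for \<open>S \<subseteq> B\<close>, lowering \<open>f\<close> by one on all points tight above \<open>S\<close> would keep \<open>f\<close>
  1-Lipschitz (by integrality and the triangle inequality) and increase the objective.
\<close>
lemma optimal_assignment_duality:
  fixes d :: "'a \<Rightarrow> 'a \<Rightarrow> nat"
  assumes finA: "finite A" and finB: "finite B" and card: "card A = card B"
    and sub: "A \<subseteq> X" "B \<subseteq> X"
    and d0: "\<And>x. x \<in> X \<Longrightarrow> d x x = 0"
    and sym: "\<And>x y. x \<in> X \<Longrightarrow> y \<in> X \<Longrightarrow> d x y = d y x"
    and tri: "\<And>x y z. x \<in> X \<Longrightarrow> y \<in> X \<Longrightarrow> z \<in> X \<Longrightarrow> d x z \<le> d x y + d y z"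
  shows "\<exists>\<phi> (f :: 'a \<Rightarrow> int). bij_betw \<phi> B A
    \<and> (\<forall>x\<in>X. \<forall>y\<in>X. f x - f y \<le> int (d x y))
    \<and> (\<forall>b\<in>B. int (d b (\<phi> b)) = f (\<phi> b) - f b)"
proof -
  define Lip where "Lip = (\<lambda>f :: 'a \<Rightarrow> int. \<forall>x\<in>X. \<forall>y\<in>X. f x - f y \<le> int (d x y))"
  define obj where "obj = (\<lambda>f :: 'a \<Rightarrow> int. sum f A - sum f B)"
  obtain \<psi> where \<psi>: "bij_betw \<psi> B A"
    using finite_same_card_bij[OF finB finA] card by auto
  \<comment> \<open>Weak duality: the cost of the arbitrary bijection \<open>\<psi>\<close> bounds
    the objective of every 1-Lipschitz function.\<close>
  have bound: "obj f \<le> (\<Sum>b\<in>B. int (d (\<psi> b) b))" if "Lip f" for f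
  proof -
    have "obj f = (\<Sum>b\<in>B. f (\<psi> b) - f b)"
      using sum.reindex_bij_betw[OF \<psi>, of f] by (simp add: obj_def sum_subtractf)
    also have "\<dots> \<le> (\<Sum>b\<in>B. int (d (\<psi> b) b))"
      using that \<psi> sub unfolding Lip_def bij_betw_def by (intro sum_mono) blast
    finally show ?thesis .
  qed
  \<comment> \<open>A bounded integral objective attains its maximum. The search is confined to
    nonnegative values, where \<open>nat\<close> loses nothing; the zero function shows that it is
    not vacuous.\<close>
  have "Lip (\<lambda>_. 0) \<and> obj (\<lambda>_. 0) \<ge> 0" by (simp add: Lip_def obj_def)
  moreover have "\<forall>f. Lip f \<and> obj f \<ge> 0 \<longrightarrow> nat (obj f) < Suc (nat (\<Sum>b\<in>B. int (d (\<psi> b) b)))"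
    using bound by (auto intro!: nat_mono le_imp_less_Suc)
  ultimately obtain f where f: "Lip f" "obj f \<ge> 0"
    and max_nat: "\<forall>g. Lip g \<and> obj g \<ge> 0 \<longrightarrow> nat (obj g) \<le> nat (obj f)"
    using ex_has_greatest_nat[of "\<lambda>f. Lip f \<and> obj f \<ge> 0" "\<lambda>_. 0" "\<lambda>f. nat (obj f)"] by blast
  have max: "obj g \<le> obj f" if "Lip g" for g
    using max_nat that f by (cases "obj g \<ge> 0") auto
  define N where "N = (\<lambda>b. {a\<in>A. f a - f b = int (d a b)})"
  have hall: "card S \<le> card (\<Union>b\<in>S. N b)" if S: "S \<subseteq> B" for S
  proof -
    define U where "U = {x\<in>X. \<exists>b\<in>S. f x - f b = int (d x b)}"
    define g where "g = (\<lambda>x. f x - of_bool (x \<in> U))"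
    have "g x - g y \<le> int (d x y)" if xy: "x \<in> X" "y \<in> X" for x y
    proof (cases "y \<in> U \<and> x \<notin> U")
      case True
      then obtain b where b: "b \<in> S" "f y - f b = int (d y b)" by (auto simp: U_def)
      have bX: "b \<in> X" using b S sub by auto
      \<comment> \<open>As \<open>x\<close> lies outside \<open>U\<close>, integrality leaves a
        slack of one between \<open>x\<close> and \<open>b\<close>, which pays for lowering
        \<open>f\<close> at \<open>y\<close> only.\<close>
      have "f x - f b \<noteq> int (d x b)" "f x - f b \<le> int (d x b)"
        using True b f xy bX by (auto simp: U_def Lip_def)
      moreover have "d x b \<le> d x y + d y b" using tri xy bX by blast
      ultimately show ?thesis using b True by (simp add: g_def)
    next
      case False
      moreover have "f x - f y \<le> int (d x y)" using f xy by (auto simp: Lip_def)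
      ultimately show ?thesis by (auto simp: g_def)
    qed
    then have "obj g \<le> obj f" by (intro max) (auto simp: Lip_def)
    moreover have "sum g A = sum f A - int (card (A \<inter> U))"
      using finA by (simp add: g_def sum_subtractf Int_def flip: of_nat_sum)
    moreover have "sum g B = sum f B - int (card (B \<inter> U))"
      using finB by (simp add: g_def sum_subtractf Int_def flip: of_nat_sum)
    ultimately have "card (B \<inter> U) \<le> card (A \<inter> U)" by (simp add: obj_def)
    \<comment> \<open>Each \<open>b\<close> in \<open>S\<close> is tight above itself because
      \<open>d b b = 0\<close>, so \<open>S\<close> lies in \<open>U\<close>.\<close>
    moreover have "card S \<le> card (B \<inter> U)"
      using finB S sub d0 by (intro card_mono) (force simp: U_def)+
    moreover have "A \<inter> U = (\<Union>b\<in>S. N b)" using sub by (auto simp: U_def N_def)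
    ultimately show ?thesis by simp
  qed
  have "\<exists>\<phi>. inj_on \<phi> B \<and> (\<forall>b\<in>B. \<phi> b \<in> N b)"
    using finA by (intro Hall_marriage finB hall) (auto simp: N_def)
  then obtain \<phi> where \<phi>: "inj_on \<phi> B" "\<forall>b\<in>B. \<phi> b \<in> N b" by blast
  then have "\<phi> ` B \<subseteq> A" by (auto simp: N_def)
  then have "\<phi> ` B = A" using finA card \<phi>(1) by (simp add: card_image card_subset_eq)
  then have "bij_betw \<phi> B A" using \<phi>(1) by (simp add: bij_betw_def)
  moreover have "\<forall>b\<in>B. int (d b (\<phi> b)) = f (\<phi> b) - f b"
    using \<phi>(2) sub sym by (auto simp: N_def subset_iff)
  ultimately show ?thesis using f(1) unfolding Lip_def by blast
qed

section \<open>The cube, Hamming distance and neighbours\<close>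

lemma cube_0: "cube 0 = {[]}"
  by (auto simp: cube_def)

lemma cube_Suc: "cube (Suc n) = Cons False ` cube n \<union> Cons True ` cube n"
  by (auto simp: cube_def length_Suc_conv image_iff)

lemma finite_cube: "finite (cube n)"
  by (induction n) (auto simp: cube_0 cube_Suc)

lemma sum_cube_Suc:
  fixes f :: "bool list \<Rightarrow> 'b::comm_monoid_add"
  shows "(\<Sum>x\<in>cube (Suc n). f x) = (\<Sum>x\<in>cube n. f (False # x)) + (\<Sum>x\<in>cube n. f (True # x))"
  unfolding cube_Suc
  by (subst sum.union_disjoint) (auto simp: finite_cube sum.reindex)

lemma card_cube: "card (cube n) = 2 ^ n"
proof (induction n)
  case (Suc n)
  then show ?case using sum_cube_Suc[of "\<lambda>_. 1 :: nat" n] by simp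
qed (simp add: cube_0)

lemma hdist_self: "hdist x x = 0"
  by (simp add: hdist_def)

lemma hdist_commute: "length x = length y \<Longrightarrow> hdist x y = hdist y x"
  unfolding hdist_def by (rule arg_cong[where f = card]) auto

lemma hdist_triangle:
  assumes "length x = length y"
  shows "hdist x z \<le> hdist x y + hdist y z"
proof -
  have "hdist x z \<le> card ({i. i < length x \<and> x ! i \<noteq> y ! i} \<union> {i. i < length y \<and> y ! i \<noteq> z ! i})"
    unfolding hdist_def using assms by (intro card_mono) auto
  then show ?thesis unfolding hdist_def using card_Un_le le_trans by blast
qed

lemma hdist_Cons: "hdist (a # x) (b # y) = of_bool (a \<noteq> b) + hdist x y"
proof -
  have "{i. i < length (a # x) \<and> (a # x) ! i \<noteq> (b # y) ! i} =
      (if a \<noteq> b then {0} else {}) \<union> Suc ` {i. i < length x \<and> x ! i \<noteq> y ! i}"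
    by (auto simp: less_Suc_eq_0_disj)
  then show ?thesis
    by (simp add: hdist_def card_image)
qed

lemma hdist_eq_0_iff: "length x = length y \<Longrightarrow> hdist x y = 0 \<longleftrightarrow> x = y"
  by (auto simp: hdist_def list_eq_iff_nth_eq)

lemma card_cube_neighbours:
  "x \<in> cube n \<Longrightarrow> card {y\<in>cube n. hdist x y = 1} = n"
proof (induction n arbitrary: x)
  case 0
  then show ?case by (simp add: cube_0 hdist_self)
next
  case (Suc n)
  then obtain a x' where x: "x = a # x'" "x' \<in> cube n"
    by (auto simp: cube_Suc)
  have zero: "hdist x' y = 0 \<longleftrightarrow> y = x'" if "y \<in> cube n" for y
    using x that by (auto simp: cube_def hdist_eq_0_iff)
  \<comment> \<open>A neighbour either flips the head and keeps the tail, or keeps the head and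
    moves the tail to a neighbour.\<close>
  have "{y\<in>cube (Suc n). hdist x y = 1} =
      insert ((\<not> a) # x') (Cons a ` {y\<in>cube n. hdist x' y = 1})"
    using x zero by (cases a) (auto simp: cube_Suc hdist_Cons)
  then show ?case
    using Suc.IH[OF x(2)] finite_cube[of n] by (auto simp: card_insert_if card_image)
qed

section \<open>Concentration of 1-Lipschitz functions on the cube\<close>

text \<open>Poincare inequality, with the variance multiplied by \<open>4 ^ n\<close> to avoid
  division. Induction on the dimension: the two facets contribute their own variances, and their
  sums differ by at most \<open>2 ^ n\<close> because points matched across the facets are at
  distance one.\<close>

lemma cube_variance_le:
  fixes f :: "bool list \<Rightarrow> real"
  assumes "\<And>x y. x \<in> cube n \<Longrightarrow> y \<in> cube n \<Longrightarrow> f x - f y \<le> real (hdist x y)"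
  shows "2 ^ n * (\<Sum>x\<in>cube n. (f x)\<^sup>2) - (\<Sum>x\<in>cube n. f x)\<^sup>2 \<le> 4 ^ n * (real n / 4)"
  using assms
proof (induction n arbitrary: f)
  case 0
  then show ?case by (simp add: cube_0)
next
  case (Suc n)
  define S where "S = (\<lambda>b. \<Sum>x\<in>cube n. f (b # x))"
  define Q where "Q = (\<lambda>b. \<Sum>x\<in>cube n. (f (b # x))\<^sup>2)"
  have IH: "2 ^ n * Q b - (S b)\<^sup>2 \<le> 4 ^ n * (real n / 4)" for b
    unfolding S_def Q_def
  proof (rule Suc.IH)
    fix x y assume "x \<in> cube n" "y \<in> cube n"
    then show "f (b # x) - f (b # y) \<le> real (hdist x y)"
      using Suc.prems[of "b # x" "b # y"] by (simp add: cube_def hdist_Cons)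
  qed
  have "\<bar>S False - S True\<bar> \<le> (\<Sum>x\<in>cube n. \<bar>f (False # x) - f (True # x)\<bar>)"
    by (simp add: S_def flip: sum_subtractf)
  also have "\<dots> \<le> (\<Sum>x\<in>cube n. 1)"
  proof (rule sum_mono)
    fix x assume "x \<in> cube n"
    then show "\<bar>f (False # x) - f (True # x)\<bar> \<le> 1"
      using Suc.prems[of "False # x" "True # x"] Suc.prems[of "True # x" "False # x"]
      by (simp add: cube_def hdist_Cons hdist_self)
  qed
  finally have "\<bar>S False - S True\<bar> \<le> 2 ^ n" by (simp add: card_cube)
  then have diff: "(S False - S True)\<^sup>2 \<le> (2 ^ n)\<^sup>2"
    by (simp add: abs_le_square_iff[symmetric])
  \<comment> \<open>Variance within the facets plus variance between them, from \<open>(a +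
    b)\<^sup>2 = 2 * a\<^sup>2 + 2 * b\<^sup>2 - (a - b)\<^sup>2\<close>.\<close>
  have "2 ^ Suc n * (Q False + Q True) - (S False + S True)\<^sup>2 =
      2 * (2 ^ n * Q False - (S False)\<^sup>2) + 2 * (2 ^ n * Q True - (S True)\<^sup>2) + (S False - S True)\<^sup>2"
    by (simp add: power2_eq_square algebra_simps)
  also have "\<dots> \<le> 2 * (4 ^ n * (real n / 4)) + 2 * (4 ^ n * (real n / 4)) + (2 ^ n)\<^sup>2"
    by (intro add_mono mult_left_mono IH diff) auto
  also have "\<dots> = 4 ^ Suc n * (real (Suc n) / 4)"
    by (simp add: power2_eq_square algebra_simps flip: power_mult_distrib)
  finally show ?case by (simp add: sum_cube_Suc S_def Q_def)
qed

text \<open>Cauchy-Schwarz against the constant 1 on \<open>A\<close>, where the sum of squares is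
  at most the one over the whole cube.\<close>

lemma sum_deviation_half_cube_le:
  fixes f :: "bool list \<Rightarrow> real"
  assumes lip: "\<And>x y. x \<in> cube n \<Longrightarrow> y \<in> cube n \<Longrightarrow> f x - f y \<le> real (hdist x y)"
    and A: "A \<subseteq> cube n" "card A = 2 ^ (n - 1)" and n: "n \<ge> 1"
    and \<mu>: "\<mu> = (\<Sum>x\<in>cube n. f x) / 2 ^ n"
  shows "\<bar>\<Sum>x\<in>A. f x - \<mu>\<bar> \<le> 2 ^ (n - 1) * sqrt (real n / 2)"
proof -
  obtain m where m: "n = Suc m" using n by (cases n) auto
  have "2 ^ n * (\<Sum>x\<in>cube n. (f x - \<mu>)\<^sup>2) - (\<Sum>x\<in>cube n. f x - \<mu>)\<^sup>2 \<le> 4 ^ n * (real n / 4)"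
    using lip by (intro cube_variance_le) simp
  \<comment> \<open>Centring at the mean removes the squared sum from the variance bound.\<close>
  moreover have "(\<Sum>x\<in>cube n. f x - \<mu>) = 0"
    by (simp add: sum_subtractf card_cube \<mu>)
  ultimately have "2 ^ n * (\<Sum>x\<in>cube n. (f x - \<mu>)\<^sup>2) \<le> 2 ^ n * (2 ^ n * (real n / 4))"
    by (simp flip: power_mult_distrib mult.assoc)
  then have var: "(\<Sum>x\<in>cube n. (f x - \<mu>)\<^sup>2) \<le> 2 ^ n * (real n / 4)"
    by (rule mult_left_le_imp_le) simp
  have "(\<Sum>x\<in>A. f x - \<mu>)\<^sup>2 \<le> (\<Sum>x\<in>A. (f x - \<mu>)\<^sup>2) * (\<Sum>x\<in>A. 1\<^sup>2)"
    using Cauchy_Schwarz_ineq_sum[of "\<lambda>x. f x - \<mu>" "\<lambda>_. 1" A] by simp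
  also have "\<dots> \<le> (2 ^ n * (real n / 4)) * 2 ^ (n - 1)"
    using A var sum_mono2[OF finite_cube A(1), of "\<lambda>x. (f x - \<mu>)\<^sup>2"]
    by (intro mult_mono) (auto simp: sum_nonneg)
  \<comment> \<open>Writing \<open>2 ^ n\<close> as \<open>2 * 2 ^ (n - 1)\<close> turns
    \<open>n / 4\<close> into \<open>n / 2\<close>.\<close>
  also have "\<dots> = (2 ^ (n - 1) * sqrt (real n / 2))\<^sup>2"
    by (simp add: m power_mult_distrib power2_eq_square[of "2 ^ _"])
  finally show ?thesis
    by (metis abs_le_square_iff abs_of_nonneg mult_nonneg_nonneg of_nat_0_le_iff real_sqrt_ge_zero
        zero_le_divide_iff zero_le_numeral zero_le_power)
qed

section \<open>Average stretch in terms of transport cost\<close>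

lemma cube_edges_eq: "cube_edges m = Sigma (cube m) (\<lambda>x. {y\<in>cube m. hdist x y = 1})"
  by (auto simp: cube_edges_def)

text \<open>The cube is regular: each vertex is the first entry of \<open>m\<close> ordered pairs.
  With \<open>g\<close> constantly 1 this also counts \<open>cube_edges m\<close>.\<close>

lemma sum_cube_edges_fst:
  fixes g :: "bool list \<Rightarrow> real"
  shows "(\<Sum>(x, y)\<in>cube_edges m. g x) = real m * (\<Sum>x\<in>cube m. g x)"
proof -
  have "(\<Sum>(x, y)\<in>cube_edges m. g x) = (\<Sum>x\<in>cube m. \<Sum>y\<in>{y\<in>cube m. hdist x y = 1}. g x)"
    unfolding cube_edges_eq by (subst sum.Sigma) (auto simp: finite_cube)
  also have "\<dots> = (\<Sum>x\<in>cube m. real m * g x)"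
    using card_cube_neighbours by (intro sum.cong) auto
  finally show ?thesis by (simp add: sum_distrib_left)
qed

lemma sum_cube_edges_swap:
  fixes g :: "bool list \<Rightarrow> real"
  shows "(\<Sum>(x, y)\<in>cube_edges m. g y) = (\<Sum>(x, y)\<in>cube_edges m. g x)"
proof -
  have "prod.swap p \<in> cube_edges m" if "p \<in> cube_edges m" for p
    using that hdist_commute[of "fst p" "snd p"] by (auto simp: cube_edges_def cube_def)
  then show ?thesis
    by (intro sum.reindex_bij_witness[of _ prod.swap prod.swap]) auto
qed

text \<open>Go from \<open>\<phi> x\<close> through \<open>\<iota> x\<close> and
  \<open>\<iota> y\<close> to \<open>\<phi> y\<close>. The middle leg has length one; each outer leg
  averages over the edges to the mean of \<open>hdist (\<iota> x) (\<phi> x)\<close> over the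
  vertices.\<close>

lemma avgstretch_le:
  assumes \<iota>: "\<And>x y. (x, y) \<in> cube_edges m \<Longrightarrow> hdist (\<iota> x) (\<iota> y) = 1"
    and len: "\<And>x. x \<in> cube m \<Longrightarrow> length (\<iota> x) = n" "\<And>x. x \<in> cube m \<Longrightarrow> length (\<phi> x) = n"
  shows "avgstretch m \<phi> \<le> 1 + 2 * ((\<Sum>x\<in>cube m. real (hdist (\<iota> x) (\<phi> x))) / 2 ^ m)"
    (is "_ \<le> 1 + 2 * (?D / _)")
proof -
  have cardE: "real (card (cube_edges m)) = real m * 2 ^ m"
    using sum_cube_edges_fst[of "\<lambda>_. 1" m] by (simp add: card_cube case_prod_beta)
  have "real (hdist (\<phi> x) (\<phi> y)) \<le> real (hdist (\<iota> x) (\<phi> x)) + 1 + real (hdist (\<iota> y) (\<phi> y))"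
    if "(x, y) \<in> cube_edges m" for x y
  proof -
    have xy: "x \<in> cube m" "y \<in> cube m" using that by (auto simp: cube_edges_def)
    have "hdist (\<phi> x) (\<phi> y) \<le> hdist (\<phi> x) (\<iota> x) + hdist (\<iota> x) (\<phi> y)"
      using len xy by (intro hdist_triangle) simp
    also have "hdist (\<iota> x) (\<phi> y) \<le> hdist (\<iota> x) (\<iota> y) + hdist (\<iota> y) (\<phi> y)"
      using len xy by (intro hdist_triangle) simp
    finally show ?thesis using \<iota>[OF that] len xy hdist_commute[of "\<phi> x" "\<iota> x"] by simp
  qed
  then have "(\<Sum>(x, y)\<in>cube_edges m. real (hdist (\<phi> x) (\<phi> y))) \<le>
      (\<Sum>(x, y)\<in>cube_edges m. real (hdist (\<iota> x) (\<phi> x)) + 1 + real (hdist (\<iota> y) (\<phi> y)))"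
    by (intro sum_mono) auto
  also have "\<dots> = (\<Sum>(x, y)\<in>cube_edges m. real (hdist (\<iota> x) (\<phi> x))) + real (card (cube_edges m))
      + (\<Sum>(x, y)\<in>cube_edges m. real (hdist (\<iota> y) (\<phi> y)))"
    by (simp add: case_prod_beta sum.distrib)
  also have "\<dots> = real m * 2 ^ m + 2 * (real m * ?D)"
    unfolding sum_cube_edges_swap[of "\<lambda>y. real (hdist (\<iota> y) (\<phi> y))"] sum_cube_edges_fst cardE by simp
  finally have *: "avgstretch m \<phi> \<le> (real m * 2 ^ m + 2 * (real m * ?D)) / (real m * 2 ^ m)"
    unfolding avgstretch_def cardE by (intro divide_right_mono) auto
  show ?thesis
  proof (cases "m = 0")
    \<comment> \<open>Without edges the bound \<open>*\<close> reads \<open>0 / 0 = 0\<close>, and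
      the right-hand side is at least one.\<close>
    case True
    then show ?thesis using * by (simp add: sum_nonneg add_nonneg_nonneg order_trans)
  next
    case False
    then have "(real m * 2 ^ m + 2 * (real m * ?D)) / (real m * 2 ^ m) = 1 + 2 * (?D / 2 ^ m)"
      by (simp add: field_simps)
    then show ?thesis using * by simp
  qed
qed

section \<open>Transport from a facet to a half-size set, and the final constant\<close>

text \<open>The factor 4 is two times two: both \<open>A\<close> and the facet deviate from the
  mean, and each edge has two endpoints.\<close>

lemma exists_bij_avgstretch_le:
  assumes n: "n \<ge> 1" and A: "A \<subseteq> cube n" "card A = 2 ^ (n - 1)"
  shows "\<exists>\<phi>. bij_betw \<phi> (cube (n - 1)) A \<and> avgstretch (n - 1) \<phi> \<le> 1 + 4 * sqrt (real n / 2)"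
proof -
  obtain m where m: "n = Suc m" using n by (cases n) auto
  define B where "B = Cons False ` cube m"
  have inj: "inj_on (Cons False) (cube m)" by simp
  have B: "B \<subseteq> cube n" "card B = 2 ^ (n - 1)"
    by (auto simp: B_def cube_def m card_image card_cube[unfolded cube_def])
  have fin: "finite A" "finite B" using A B finite_cube finite_subset by blast+
  have "\<exists>\<psi> (f :: bool list \<Rightarrow> int). bij_betw \<psi> B A
      \<and> (\<forall>x\<in>cube n. \<forall>y\<in>cube n. f x - f y \<le> int (hdist x y))
      \<and> (\<forall>b\<in>B. int (hdist b (\<psi> b)) = f (\<psi> b) - f b)"
    using A B fin
    by (intro optimal_assignment_duality) (auto simp: hdist_self hdist_commute hdist_triangle cube_def)
  then obtain \<psi> and f :: "bool list \<Rightarrow> int" where \<psi>: "bij_betw \<psi> B A"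
    and lip: "\<forall>x\<in>cube n. \<forall>y\<in>cube n. f x - f y \<le> int (hdist x y)"
    and tight: "\<forall>b\<in>B. int (hdist b (\<psi> b)) = f (\<psi> b) - f b" by blast
  define F where "F = (\<lambda>x. real_of_int (f x))"
  define \<mu> where "\<mu> = (\<Sum>x\<in>cube n. F x) / 2 ^ n"
  have lipF: "F x - F y \<le> real (hdist x y)" if "x \<in> cube n" "y \<in> cube n" for x y
    using lip that unfolding F_def by (metis of_int_diff of_int_le_iff of_int_of_nat_eq)
  have tightF: "real (hdist b (\<psi> b)) = F (\<psi> b) - F b" if "b \<in> B" for b
    using tight that unfolding F_def by (metis of_int_diff of_int_of_nat_eq)
  have "(\<Sum>b\<in>B. real (hdist b (\<psi> b))) = (\<Sum>b\<in>B. F (\<psi> b) - F b)"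
    using tightF by (intro sum.cong) auto
  also have "\<dots> = sum F A - sum F B"
    using sum.reindex_bij_betw[OF \<psi>, of F] by (simp add: sum_subtractf)
  \<comment> \<open>\<open>A\<close> and \<open>B\<close> have the same size, so the subtracted
    means cancel.\<close>
  also have "\<dots> = (\<Sum>a\<in>A. F a - \<mu>) - (\<Sum>b\<in>B. F b - \<mu>)"
    using A B by (simp add: sum_subtractf)
  also have "\<dots> \<le> 2 ^ m * (2 * sqrt (real n / 2))"
    using sum_deviation_half_cube_le[OF lipF A n \<mu>_def] sum_deviation_half_cube_le[OF lipF B n \<mu>_def]
    by (simp add: m)
  finally have cost: "(\<Sum>x\<in>cube m. real (hdist (False # x) (\<psi> (False # x)))) / 2 ^ m \<le> 2 * sqrt (real n / 2)"
    by (simp add: B_def sum.reindex divide_le_eq mult.commute)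
  define \<phi> where "\<phi> = \<psi> \<circ> Cons False"
  have bij: "bij_betw \<phi> (cube m) A"
    unfolding \<phi>_def using \<psi> inj by (intro bij_betw_trans) (auto simp: B_def bij_betw_def)
  have "avgstretch m \<phi> \<le> 1 + 2 * ((\<Sum>x\<in>cube m. real (hdist (False # x) (\<phi> x))) / 2 ^ m)"
  proof (rule avgstretch_le[where n = n])
    show "length (\<phi> x) = n" if "x \<in> cube m" for x
      using bij A(1) that by (auto simp: bij_betw_def cube_def)
  qed (auto simp: cube_edges_def hdist_Cons cube_def m)
  then have "avgstretch m \<phi> \<le> 1 + 4 * sqrt (real n / 2)"
    using cost by (simp add: \<phi>_def)
  then show ?thesis using bij m by auto
qed

theorem theorem1:
  shows "\<exists>C::real. C > 0 \<and>
    (\<forall>n::nat. n \<ge> 1 \<longrightarrow>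
      (\<forall>A. A \<subseteq> cube n \<and> card A = 2 ^ (n - 1) \<longrightarrow>
        (\<exists>\<phi>. bij_betw \<phi> (cube (n - 1)) A \<and> avgstretch (n - 1) \<phi> \<le> C * sqrt (real n))))"
\<comment> \<open>The constant is 1 + 4: since \<open>n \<ge> 1\<close>, the additive 1 is at most
  \<open>sqrt n\<close>.\<close>
proof (intro exI[of _ 5] conjI allI impI)
  fix n :: nat and A :: "bool list set"
  assume n: "n \<ge> 1" and A: "A \<subseteq> cube n \<and> card A = 2 ^ (n - 1)"
  have "1 \<le> sqrt (real n)" "sqrt (real n / 2) \<le> sqrt (real n)"
    using n by auto
  then have "1 + 4 * sqrt (real n / 2) \<le> 5 * sqrt (real n)" by linarith
  then show "\<exists>\<phi>. bij_betw \<phi> (cube (n - 1)) A \<and> avgstretch (n - 1) \<phi> \<le> 5 * sqrt (real n)"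
    using exists_bij_avgstretch_le[OF n] A by (meson order_trans)
qed simp

end
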